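(* Let $K\ge 2$, $Y=(Y_1,\dots,Y_K)'\in\mathbb{R}^K$, $\sigma_1,\dots,\sigma_K>0$, and $\lambda^0\in\Delta(\mathcal{V})$. For $\epsilon\in[0,1]$ consider the perturbation class $\Lambda_\epsilon(\lambda^0)=\{(1-\epsilon)\lambda^0+\epsilon q:q\in\Delta(\mathcal{V})\}$, with worst-case posterior risk $R_\epsilon(a|Y)$ and optimal headline $\hat\theta_\epsilon^*(Y)$ (see context). Then $$\hat\theta_\epsilon^*(Y)=\arg\min_{a\in\mathbb{R}}R_\epsilon(a|Y),\qquad R_\epsilon(a|Y)=\left((1-\epsilon)\sum_{k=1}^K\lambda_k^0D_k(a|Y)^2+\epsilon\max_{k\in[K]}D_k(a|Y)^2\right)+1.$$ With $R_\epsilon^*(Y)=R_\epsilon(\hat\theta_\epsilon^*(Y)|Y)$, the solution can be computed as $$\lambda_\epsilon^*\in\arg\max\{\rho(\lambda|Y):\lambda\in\Delta(\mathcal{V}),\ \lambda\ge(1-\epsilon)\lambda^0\},\qquad \hat\theta_\epsilon^*(Y)=a(\lambda_\epsilon^*|Y),\qquad R_\epsilon^*(Y)=\rho(\lambda_\epsilon^*|Y)+1.$$ The optimal headline is continuous in $\epsilon$ and follows a monotone path between its endpoints: if $\hat\theta_0^*(Y)<\hat\theta_1^*(Y)$, then $\epsilon\mapsto\hat\theta_\epsilon^*(Y)$ is nondecreasing; if $\hat\theta_0^*(Y)>\hat\theta_1^*(Y)$, then it is nonincreasing; and if the endpoints coincide, then the path is constant. At the endpoints, $$\hat\theta_0^*(Y)=a(\lambda^0|Y)=\frac{\sum_{k=1}^K\lambda_k^0Y_k/\sigma_k^2}{\sum_{k=1}^K\lambda_k^0/\sigma_k^2},\qquad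 \hat\theta_1^*(Y)=\hat\theta_\Delta^*(Y).$$ For $K=2$, let $p^0=\lambda_1^0$, $p_\Delta=\sigma_1/(\sigma_1+\sigma_2)$, $\mathcal{I}_\epsilon=[(1-\epsilon)p^0,\,(1-\epsilon)p^0+\epsilon]$, and $$p_\epsilon^*=\arg\min_{p\in\mathcal{I}_\epsilon}|p-p_\Delta|=\min\{\max\{p_\Delta,(1-\epsilon)p^0\},(1-\epsilon)p^0+\epsilon\}.$$ In this case, $$\hat\theta_\epsilon^*(Y)=\frac{p_\epsilon^*Y_1/\sigma_1^2+(1-p_\epsilon^* )Y_2/\sigma_2^2}{p_\epsilon^*/\sigma_1^2+(1-p_\epsilon^* )/\sigma_2^2},\qquad R_\epsilon^*(Y)=\frac{p_\epsilon^*(1-p_\epsilon^* )(Y_1-Y_2)^2}{p_\epsilon^*\sigma_2^2+(1-p_\epsilon^* )\sigma_1^2}+1.$$ If $p_\Delta\in\mathcal{I}_\epsilon$, then $\hat\theta_\epsilon^*(Y)=\hat\theta_\Delta^*(Y)$. In particular, when $p^0\in(0,1)$, $\hat\theta_\epsilon^*(Y)=\hat\theta_\Delta^*(Y)$ if $\epsilon\ge\max\{1-(p_\Delta/p^0),\,1-(1-p_\Delta)/(1-p^0)\}$.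
   Context: $[K]=\{1,\dots,K\}$ and $\Delta(\mathcal{V})=\{\lambda\in\mathbb{R}^K:\lambda\ge 0,\ \sum_{k=1}^K\lambda_k=1\}$; vector inequalities are componentwise. Let $D_k(a|Y)=|Y_k-a|/\sigma_k$ for $a\in\mathbb{R}$. For a nonempty, compact, convex class $\Lambda\subseteq\Delta(\mathcal{V})$, the worst-case posterior risk of $a$ is $R_\Lambda(a|Y)=\max_{\lambda\in\Lambda}\sum_{k=1}^K\lambda_kD_k(a|Y)^2+1$ and the optimal headline is its unique minimizer over $a\in\mathbb{R}$. $R_\epsilon(a|Y)$ and $\hat\theta_\epsilon^*(Y)$ denote these objects for $\Lambda=\Lambda_\epsilon(\lambda^0)$, and $\hat\theta_\Delta^*(Y)$ denotes the optimal headline for $\Lambda=\Delta(\mathcal{V})$. For $\lambda\in\Delta(\mathcal{V})$, $$a(\lambda|Y)=\frac{\sum_{k}\lambda_kY_k/\sigma_k^2}{\sum_{k}\lambda_k/\sigma_k^2},\qquad \rho(\lambda|Y)=\sum_{k}\lambda_kD_k(a(\lambda|Y)|Y)^2.$$ "The solution can be computed as" means that the displayed identities hold for any maximizer $\lambda_\epsilon^*$. *)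

theory Defs
  imports "HOL-Analysis.Analysis"
begin

text \<open>
  The index set \<open>[K]\<close> is a finite type \<open>'k\<close> with \<open>K = CARD('k)\<close>, so vectors in \<open>\<real>\<^sup>K\<close>
  are elements of \<^typ>\<open>real ^ 'k\<close>, and \<open>\<le>\<close> on them is the componentwise order.
\<close>

definition prob_simplex :: "(real ^ 'k) set" where
  "prob_simplex = {lam. 0 \<le> lam \<and> (\<Sum>k\<in>UNIV. lam $ k) = 1}"

definition std_dist :: "real ^ 'k \<Rightarrow> real ^ 'k \<Rightarrow> 'k \<Rightarrow> real \<Rightarrow> real" where
  "std_dist \<sigma> Y k a = \<bar>Y $ k - a\<bar> / \<sigma> $ k"

definition weighted_loss :: "real ^ 'k \<Rightarrow> real ^ 'k \<Rightarrow> real ^ 'k \<Rightarrow> real \<Rightarrow> real" where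
  "weighted_loss \<sigma> Y lam a = (\<Sum>k\<in>UNIV. lam $ k * (std_dist \<sigma> Y k a)\<^sup>2)"

text \<open>
  The supremum is a maximum for nonempty compact \<open>\<Lambda>\<close>; see \<open>worst_case_risk_attained\<close> below.
\<close>

definition worst_case_risk ::
  "real ^ 'k \<Rightarrow> real ^ 'k \<Rightarrow> (real ^ 'k) set \<Rightarrow> real \<Rightarrow> real" where
  "worst_case_risk \<sigma> Y \<Lambda> a = (SUP lam\<in>\<Lambda>. weighted_loss \<sigma> Y lam a) + 1"

text \<open>
  \<^const>\<open>arg_min\<close> is a choice operator: it denotes the minimizer only where a
  unique one exists.
\<close>

definition optimal_headline ::
  "real ^ 'k \<Rightarrow> real ^ 'k \<Rightarrow> (real ^ 'k) set \<Rightarrow> real" where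
  "optimal_headline \<sigma> Y \<Lambda> = arg_min (worst_case_risk \<sigma> Y \<Lambda>) (\<lambda>_. True)"

definition perturbation_class :: "real ^ 'k \<Rightarrow> real \<Rightarrow> (real ^ 'k) set" where
  "perturbation_class lam0 eps = {(1 - eps) *\<^sub>R lam0 + eps *\<^sub>R q | q. q \<in> prob_simplex}"

definition precision_mean :: "real ^ 'k \<Rightarrow> real ^ 'k \<Rightarrow> real ^ 'k \<Rightarrow> real" where
  "precision_mean \<sigma> Y lam =
     (\<Sum>k\<in>UNIV. lam $ k * Y $ k / (\<sigma> $ k)\<^sup>2) / (\<Sum>k\<in>UNIV. lam $ k / (\<sigma> $ k)\<^sup>2)"

definition dispersion :: "real ^ 'k \<Rightarrow> real ^ 'k \<Rightarrow> real ^ 'k \<Rightarrow> real" where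
  "dispersion \<sigma> Y lam =
     (\<Sum>k\<in>UNIV. lam $ k * (std_dist \<sigma> Y k (precision_mean \<sigma> Y lam))\<^sup>2)"

definition p_Delta :: "real \<Rightarrow> real \<Rightarrow> real" where
  "p_Delta s1 s2 = s1 / (s1 + s2)"

definition weight_interval :: "real \<Rightarrow> real \<Rightarrow> real set" where
  "weight_interval p0 eps = {(1 - eps) * p0 .. (1 - eps) * p0 + eps}"

definition p_star :: "real \<Rightarrow> real \<Rightarrow> real \<Rightarrow> real \<Rightarrow> real" where
  "p_star s1 s2 p0 eps = arg_min_on (\<lambda>p. \<bar>p - p_Delta s1 s2\<bar>) (weight_interval p0 eps)"

lemma worst_case_risk_attained:
  fixes \<sigma> Y :: "real ^ 'k" and \<Lambda> :: "(real ^ 'k) set"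
  assumes "compact \<Lambda>" "\<Lambda> \<noteq> {}"
  obtains lam where "lam \<in> \<Lambda>"
    and "worst_case_risk \<sigma> Y \<Lambda> a = weighted_loss \<sigma> Y lam a + 1"
    and "\<And>mu. mu \<in> \<Lambda> \<Longrightarrow> weighted_loss \<sigma> Y mu a \<le> weighted_loss \<sigma> Y lam a"
proof -
  have "continuous_on \<Lambda> (\<lambda>lam. weighted_loss \<sigma> Y lam a)"
    unfolding weighted_loss_def by (intro continuous_intros)
  then obtain lam where lam: "lam \<in> \<Lambda>"
    "\<And>mu. mu \<in> \<Lambda> \<Longrightarrow> weighted_loss \<sigma> Y mu a \<le> weighted_loss \<sigma> Y lam a"
    using continuous_attains_sup[OF assms] by metis
  have "(SUP mu\<in>\<Lambda>. weighted_loss \<sigma> Y mu a) = weighted_loss \<sigma> Y lam a"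
    by (rule cSup_eq_maximum) (use lam in auto)
  then show thesis
    using lam that unfolding worst_case_risk_def by simp
qed

lemma compact_prob_simplex: "compact (prob_simplex :: (real ^ 'k) set)"
proof -
  have eq: "(prob_simplex :: (real ^ 'k) set) =
      (\<Inter>k. {lam. 0 \<le> lam $ k}) \<inter> {lam. (\<Sum>k\<in>UNIV. lam $ k) = 1}"
    by (auto simp: prob_simplex_def less_eq_vec_def)
  have "closed (prob_simplex :: (real ^ 'k) set)"
    unfolding eq
    by (intro closed_Int closed_INT ballI closed_Collect_le closed_Collect_eq continuous_intros)
  moreover have "norm lam \<le> 1" if "lam \<in> prob_simplex" for lam :: "real ^ 'k"
  proof -
    have "norm lam \<le> (\<Sum>k\<in>UNIV. \<bar>lam $ k\<bar>)"
      by (rule norm_le_l1_cart)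
    also have "\<dots> = (\<Sum>k\<in>UNIV. lam $ k)"
      using that by (intro sum.cong) (auto simp: prob_simplex_def less_eq_vec_def)
    finally show ?thesis
      using that by (simp add: prob_simplex_def)
  qed
  then have "bounded (prob_simplex :: (real ^ 'k) set)"
    unfolding bounded_iff by blast
  ultimately show ?thesis
    by (simp add: compact_eq_bounded_closed)
qed

lemma perturbation_class_eq_image:
  "perturbation_class lam0 eps = (\<lambda>q. (1 - eps) *\<^sub>R lam0 + eps *\<^sub>R q) ` prob_simplex"
  unfolding perturbation_class_def by auto

lemma compact_perturbation_class: "compact (perturbation_class lam0 eps)"
  unfolding perturbation_class_eq_image
  by (intro compact_continuous_image continuous_intros compact_prob_simplex)

lemma perturbation_class_nonempty:
  "lam0 \<in> prob_simplex \<Longrightarrow> perturbation_class lam0 eps \<noteq> {}"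
  unfolding perturbation_class_eq_image by auto

lemma convex_prob_simplex: "convex (prob_simplex :: (real ^ 'k) set)"
  by (rule convexI)
     (auto simp: prob_simplex_def less_eq_vec_def sum.distrib simp flip: sum_distrib_left)

lemma perturbation_class_subset:
  assumes "lam0 \<in> prob_simplex" "eps \<in> {0..1}"
  shows "perturbation_class lam0 eps \<subseteq> prob_simplex"
  using assms unfolding perturbation_class_def
  by (auto intro!: convexD[OF convex_prob_simplex])

lemma convex_perturbation_class: "convex (perturbation_class lam0 eps)"
proof -
  have "perturbation_class lam0 eps =
      (+) ((1 - eps) *\<^sub>R lam0) ` (\<lambda>q. eps *\<^sub>R q) ` prob_simplex"
    unfolding perturbation_class_eq_image by (simp add: image_image)
  then show ?thesis
    by (simp add: convex_prob_simplex convex_scaling convex_translation)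
qed

end

theory Submission
  imports Defs
begin

text \<open>
  Completing the square, the loss under weights \<open>\<lambda>\<close> is \<open>w (a - a(\<lambda>))\<^sup>2 + \<rho>(\<lambda>)\<close> with \<open>w > 0\<close>
  bounded below on the simplex. If \<open>\<lambda>\<close> maximizes \<open>\<rho>\<close> over a convex class, then \<open>(a(\<lambda>), \<lambda>)\<close> is a saddle
  point of the loss, so the worst-case risk is minimal at \<open>a(\<lambda>)\<close> and grows quadratically around it.
  For the perturbation classes the worst-case risk is an interpolation \<open>(1 - \<epsilon>) f + \<epsilon> g\<close> of two
  convex functions of one real variable; its minimizers move monotonically because \<open>f\<close> cannot
  decrease along the path as \<open>\<epsilon>\<close> grows, and continuously because of the quadratic growth. For two
  sources \<open>\<rho>\<close> is unimodal in the first weight with peak at \<open>p\<^sub>\<Delta>\<close>, so its maximizer over an interval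
  is the projection of \<open>p\<^sub>\<Delta>\<close>.
\<close>

subsection \<open>Worst-case risk and maximal dispersion\<close>

text \<open>The denominator of \<open>precision_mean\<close>, and at the same time the leading
  coefficient of the loss as a quadratic in \<open>a\<close>.\<close>

definition total_precision :: "real ^ 'k \<Rightarrow> real ^ 'k \<Rightarrow> real" where
  "total_precision \<sigma> lam = (\<Sum>k\<in>UNIV. lam $ k / (\<sigma> $ k)\<^sup>2)"

lemma prob_simplex_nonneg: "lam \<in> prob_simplex \<Longrightarrow> 0 \<le> lam $ k"
  by (simp add: prob_simplex_def less_eq_vec_def)

lemma prob_simplex_sum: "lam \<in> prob_simplex \<Longrightarrow> (\<Sum>k\<in>UNIV. lam $ k) = 1"
  by (simp add: prob_simplex_def)

lemma axis_in_prob_simplex: "axis k 1 \<in> prob_simplex"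
  by (simp add: prob_simplex_def less_eq_vec_def axis_def)

text \<open>A mean with weights summing to one is at least the smallest of the averaged values. The
  bound is uniform over the simplex, so that a single growth constant serves all
  \<open>eps\<close>.\<close>

lemma total_precision_bounded_below:
  fixes \<sigma> :: "real ^ 'k"
  assumes "\<And>k. \<sigma> $ k > 0"
  obtains c where "c > 0" "\<And>lam. lam \<in> prob_simplex \<Longrightarrow> c \<le> total_precision \<sigma> lam"
proof
  let ?c = "MIN k. 1 / (\<sigma> $ k)\<^sup>2"
  show "?c > 0"
    using assms by (simp add: less_imp_neq[OF assms, symmetric])
  fix lam :: "real ^ 'k" assume lam: "lam \<in> prob_simplex"
  have "?c = (\<Sum>k\<in>UNIV. lam $ k * ?c)"
    by (simp add: prob_simplex_sum[OF lam] flip: sum_distrib_right)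
  also have "\<dots> \<le> (\<Sum>k\<in>UNIV. lam $ k * (1 / (\<sigma> $ k)\<^sup>2))"
    by (intro sum_mono mult_left_mono prob_simplex_nonneg[OF lam] Min_le) auto
  finally show "?c \<le> total_precision \<sigma> lam"
    by (simp add: total_precision_def)
qed

lemma total_precision_pos:
  assumes "\<And>k. \<sigma> $ k > 0" "lam \<in> prob_simplex"
  shows "total_precision \<sigma> lam > 0"
  using total_precision_bounded_below[OF assms(1)] assms(2) by (metis less_le_trans)

lemma dispersion_eq_weighted_loss:
  "dispersion \<sigma> Y lam = weighted_loss \<sigma> Y lam (precision_mean \<sigma> Y lam)"
  by (simp add: dispersion_def weighted_loss_def)

lemma weighted_loss_decomp:
  assumes "\<And>k. \<sigma> $ k > 0" "lam \<in> prob_simplex"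
  shows "weighted_loss \<sigma> Y lam a =
    total_precision \<sigma> lam * (a - precision_mean \<sigma> Y lam)\<^sup>2 + dispersion \<sigma> Y lam"
proof -
  \<comment> \<open>\<open>S1\<close> and \<open>S2\<close> weight \<open>Y\<close> and its square
    by \<open>lam $ k / (\<sigma> $ k)\<^sup>2\<close>. The loss becomes a quadratic in
    \<open>b\<close> with vertex \<open>S1 / total_precision \<sigma> lam\<close>.\<close>
  define S1 where "S1 = (\<Sum>k\<in>UNIV. lam $ k * Y $ k / (\<sigma> $ k)\<^sup>2)"
  define S2 where "S2 = (\<Sum>k\<in>UNIV. lam $ k * (Y $ k)\<^sup>2 / (\<sigma> $ k)\<^sup>2)"
  define m where "m = precision_mean \<sigma> Y lam"
  have expand: "weighted_loss \<sigma> Y lam b = S2 - 2 * b * S1 + b\<^sup>2 * total_precision \<sigma> lam" for b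
    unfolding weighted_loss_def S1_def S2_def total_precision_def std_dist_def
      sum_distrib_left sum_subtractf[symmetric] sum.distrib[symmetric]
    by (intro sum.cong refl)
       (simp add: power_divide power2_diff add_divide_distrib diff_divide_distrib algebra_simps)
  have "S1 = m * total_precision \<sigma> lam"
    using total_precision_pos[OF assms]
    by (simp add: m_def precision_mean_def S1_def total_precision_def)
  then show ?thesis
    unfolding dispersion_eq_weighted_loss m_def[symmetric] expand
    by (simp add: power2_eq_square algebra_simps)
qed

lemma dispersion_le_weighted_loss:
  assumes "\<And>k. \<sigma> $ k > 0" "lam \<in> prob_simplex"
  shows "dispersion \<sigma> Y lam \<le> weighted_loss \<sigma> Y lam a"
  using weighted_loss_decomp[OF assms] total_precision_pos[OF assms] by simp

lemma continuous_on_precision_mean: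
  assumes "\<And>k. \<sigma> $ k > 0"
  shows "continuous_on prob_simplex (precision_mean \<sigma> Y)"
  unfolding precision_mean_def
  using assms total_precision_pos[OF assms] unfolding total_precision_def
  by (intro continuous_intros) (auto simp: less_imp_neq[symmetric])

lemma continuous_on_dispersion:
  assumes "\<And>k. \<sigma> $ k > 0"
  shows "continuous_on prob_simplex (dispersion \<sigma> Y)"
  unfolding dispersion_def std_dist_def
  using assms by (intro continuous_intros continuous_on_precision_mean) (auto simp: less_imp_neq[symmetric])

lemma weighted_loss_convex_combination:
  "weighted_loss \<sigma> Y ((1 - t) *\<^sub>R lam + t *\<^sub>R mu) a =
    (1 - t) * weighted_loss \<sigma> Y lam a + t * weighted_loss \<sigma> Y mu a"
  by (simp add: weighted_loss_def sum_distrib_left algebra_simps sum.distrib sum_subtractf)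

text \<open>
  Moving from the maximizer towards \<open>\<mu>\<close> cannot increase the dispersion, which bounds the loss
  of \<open>\<mu>\<close> at the precision mean of the moved weights; then the step length tends to zero.
\<close>

lemma weighted_loss_le_max_dispersion:
  fixes \<sigma> Y lam mu :: "real ^ 'k"
  assumes pos: "\<And>k. \<sigma> $ k > 0" and sub: "\<Lambda> \<subseteq> prob_simplex" and "convex \<Lambda>"
    and max: "is_arg_max (dispersion \<sigma> Y) (\<lambda>lam. lam \<in> \<Lambda>) lam" and mu: "mu \<in> \<Lambda>"
  shows "weighted_loss \<sigma> Y mu (precision_mean \<sigma> Y lam) \<le> dispersion \<sigma> Y lam"
proof -
  define nu where "nu t = (1 - t) *\<^sub>R lam + t *\<^sub>R mu" for t
  have lam: "lam \<in> \<Lambda>"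
    using max by (simp add: is_arg_max_def)
  have nu_in: "nu t \<in> \<Lambda>" if "t \<in> {0..1}" for t
    using that lam mu \<open>convex \<Lambda>\<close> by (auto simp: nu_def convex_alt)
  have le: "weighted_loss \<sigma> Y mu (precision_mean \<sigma> Y (nu t)) \<le> dispersion \<sigma> Y lam"
    if t: "t \<in> {0<..1}" for t
  proof -
    let ?a = "precision_mean \<sigma> Y (nu t)"
    \<comment> \<open>The loss is linear in the weights, so the dispersion of \<open>nu t\<close>
      splits into the losses of \<open>lam\<close> and \<open>mu\<close> at the common point
      \<open>?a\<close>. The first is at least its own minimum,
      \<open>dispersion \<sigma> Y lam\<close>; cancelling and dividing by \<open>t > 0\<close>
      leaves the bound for \<open>mu\<close>.\<close>
    have "(1 - t) * dispersion \<sigma> Y lam + t * weighted_loss \<sigma> Y mu ?a \<le>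
        (1 - t) * weighted_loss \<sigma> Y lam ?a + t * weighted_loss \<sigma> Y mu ?a"
      using t lam sub pos by (intro add_right_mono mult_left_mono dispersion_le_weighted_loss) auto
    also have "\<dots> = dispersion \<sigma> Y (nu t)"
      unfolding dispersion_eq_weighted_loss by (simp add: nu_def weighted_loss_convex_combination)
    also have "\<dots> \<le> dispersion \<sigma> Y lam"
      using max nu_in[of t] t by (force simp: is_arg_max_linorder)
    finally have "t * weighted_loss \<sigma> Y mu ?a \<le> t * dispersion \<sigma> Y lam"
      by (simp add: algebra_simps)
    then show ?thesis
      using t by simp
  qed
  have "continuous_on {0..1} (\<lambda>t. precision_mean \<sigma> Y (nu t))"
    by (rule continuous_on_compose2[OF continuous_on_precision_mean[OF pos]])
       (use nu_in sub in \<open>auto simp: nu_def intro!: continuous_intros\<close>)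
  then have "continuous_on {0..1} (\<lambda>t. weighted_loss \<sigma> Y mu (precision_mean \<sigma> Y (nu t)))"
    unfolding weighted_loss_def std_dist_def
    using pos by (intro continuous_intros) (auto simp: less_imp_neq[symmetric])
  then have "((\<lambda>t. weighted_loss \<sigma> Y mu (precision_mean \<sigma> Y (nu t))) \<longlongrightarrow>
      weighted_loss \<sigma> Y mu (precision_mean \<sigma> Y (nu 0))) (at_right 0)"
    by (metis continuous_on_Icc_at_rightD zero_less_one)
  then have "weighted_loss \<sigma> Y mu (precision_mean \<sigma> Y (nu 0)) \<le> dispersion \<sigma> Y lam"
  proof (rule tendsto_upperbound)
    show "\<forall>\<^sub>F t in at_right 0. weighted_loss \<sigma> Y mu (precision_mean \<sigma> Y (nu t)) \<le> dispersion \<sigma> Y lam"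
      unfolding eventually_at_right_field using le by (intro exI[of _ 1]) auto
  qed simp
  then show ?thesis
    by (simp add: nu_def)
qed

lemma weighted_loss_le_worst_case_risk:
  assumes "compact \<Lambda>" "lam \<in> \<Lambda>"
  shows "weighted_loss \<sigma> Y lam a + 1 \<le> worst_case_risk \<sigma> Y \<Lambda> a"
  using worst_case_risk_attained[of \<Lambda> \<sigma> Y a] assms
  by (metis add_right_mono empty_iff)

text \<open>Saddle point: at the precision mean of \<open>lam\<close> no weights in the class lose
  more than \<open>lam\<close> itself. At any other \<open>a\<close> the worst case is at least the
  loss of \<open>lam\<close>, whose completed square supplies the quadratic term.\<close>

lemma worst_case_risk_at_max_dispersion:
  fixes \<sigma> Y lam :: "real ^ 'k"
  assumes pos: "\<And>k. \<sigma> $ k > 0" and sub: "\<Lambda> \<subseteq> prob_simplex" and "convex \<Lambda>" and "compact \<Lambda>"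
    and max: "is_arg_max (dispersion \<sigma> Y) (\<lambda>lam. lam \<in> \<Lambda>) lam"
  shows "worst_case_risk \<sigma> Y \<Lambda> (precision_mean \<sigma> Y lam) = dispersion \<sigma> Y lam + 1"
    and "worst_case_risk \<sigma> Y \<Lambda> (precision_mean \<sigma> Y lam) +
      total_precision \<sigma> lam * (a - precision_mean \<sigma> Y lam)\<^sup>2 \<le> worst_case_risk \<sigma> Y \<Lambda> a"
proof -
  have lam: "lam \<in> \<Lambda>"
    using max by (simp add: is_arg_max_def)
  show eq: "worst_case_risk \<sigma> Y \<Lambda> (precision_mean \<sigma> Y lam) = dispersion \<sigma> Y lam + 1"
  proof (rule antisym)
    obtain mu where "mu \<in> \<Lambda>" "worst_case_risk \<sigma> Y \<Lambda> (precision_mean \<sigma> Y lam) =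
        weighted_loss \<sigma> Y mu (precision_mean \<sigma> Y lam) + 1"
      using worst_case_risk_attained \<open>compact \<Lambda>\<close> lam by (metis empty_iff)
    then show "worst_case_risk \<sigma> Y \<Lambda> (precision_mean \<sigma> Y lam) \<le> dispersion \<sigma> Y lam + 1"
      using weighted_loss_le_max_dispersion[OF pos sub \<open>convex \<Lambda>\<close> max] by simp
  qed (use weighted_loss_le_worst_case_risk[OF \<open>compact \<Lambda>\<close> lam]
      in \<open>simp add: dispersion_eq_weighted_loss\<close>)
  show "worst_case_risk \<sigma> Y \<Lambda> (precision_mean \<sigma> Y lam) +
      total_precision \<sigma> lam * (a - precision_mean \<sigma> Y lam)\<^sup>2 \<le> worst_case_risk \<sigma> Y \<Lambda> a"
    using weighted_loss_le_worst_case_risk[OF \<open>compact \<Lambda>\<close> lam, of \<sigma> Y a] lam sub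
      weighted_loss_decomp[OF pos, of lam Y a]
    unfolding eq by auto
qed

text \<open>Quadratic growth with a positive coefficient makes the minimizer strict, hence unique,
  so the choice operator in \<open>optimal_headline\<close> denotes it. Every maximizer of the
  dispersion therefore has the same precision mean.\<close>

lemma optimal_headline_eq_precision_mean:
  fixes \<sigma> Y lam :: "real ^ 'k"
  assumes pos: "\<And>k. \<sigma> $ k > 0" and sub: "\<Lambda> \<subseteq> prob_simplex" and "convex \<Lambda>" and "compact \<Lambda>"
    and max: "is_arg_max (dispersion \<sigma> Y) (\<lambda>lam. lam \<in> \<Lambda>) lam"
  shows "is_arg_min (worst_case_risk \<sigma> Y \<Lambda>) (\<lambda>_. True) a \<longleftrightarrow> a = precision_mean \<sigma> Y lam"
    and "optimal_headline \<sigma> Y \<Lambda> = precision_mean \<sigma> Y lam"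
proof -
  let ?m = "precision_mean \<sigma> Y lam"
  have tp: "total_precision \<sigma> lam > 0"
    using max sub by (intro total_precision_pos[OF pos]) (auto simp: is_arg_max_def)
  have less: "worst_case_risk \<sigma> Y \<Lambda> ?m < worst_case_risk \<sigma> Y \<Lambda> b" if "b \<noteq> ?m" for b
  proof -
    have "0 < total_precision \<sigma> lam * (b - ?m)\<^sup>2"
      using tp that by simp
    then show ?thesis
      using worst_case_risk_at_max_dispersion(2)[OF assms, of b] by linarith
  qed
  have iff: "is_arg_min (worst_case_risk \<sigma> Y \<Lambda>) (\<lambda>_. True) b \<longleftrightarrow> b = ?m" for b
    using less unfolding is_arg_min_linorder by (metis less_le_not_le order_refl)
  show "is_arg_min (worst_case_risk \<sigma> Y \<Lambda>) (\<lambda>_. True) a \<longleftrightarrow> a = ?m"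
    by (rule iff)
  show "optimal_headline \<sigma> Y \<Lambda> = ?m"
    unfolding optimal_headline_def arg_min_def iff by simp
qed

lemma max_dispersion_exists:
  fixes \<sigma> Y :: "real ^ 'k"
  assumes "\<And>k. \<sigma> $ k > 0" "\<Lambda> \<subseteq> prob_simplex" "compact \<Lambda>" "\<Lambda> \<noteq> {}"
  obtains lam where "is_arg_max (dispersion \<sigma> Y) (\<lambda>lam. lam \<in> \<Lambda>) lam"
  using continuous_attains_sup[OF assms(3,4) continuous_on_subset[OF continuous_on_dispersion assms(2)]]
    assms(1) that unfolding is_arg_max_linorder by metis

subsection \<open>Perturbation classes\<close>

text \<open>Weights above \<open>(1 - eps) *\<^sub>R lam0\<close> leave a nonnegative remainder of
  total mass \<open>eps\<close>, which scaled by \<open>1 / eps\<close> is the contaminating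
  \<open>q\<close>.\<close>

lemma perturbation_class_eq_lower_bounded:
  fixes lam0 :: "real ^ 'k"
  assumes lam0: "lam0 \<in> prob_simplex" and eps: "eps \<in> {0..1}"
  shows "perturbation_class lam0 eps = {lam \<in> prob_simplex. (1 - eps) *\<^sub>R lam0 \<le> lam}"
proof (intro equalityI subsetI)
  fix lam assume lam: "lam \<in> perturbation_class lam0 eps"
  then show "lam \<in> {lam \<in> prob_simplex. (1 - eps) *\<^sub>R lam0 \<le> lam}"
    using perturbation_class_subset[OF assms] eps
    by (auto simp: perturbation_class_def less_eq_vec_def prob_simplex_nonneg)
next
  fix lam assume "lam \<in> {lam \<in> prob_simplex. (1 - eps) *\<^sub>R lam0 \<le> lam}"
  then have lam: "lam \<in> prob_simplex" and le: "(1 - eps) * lam0 $ k \<le> lam $ k" for k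
    by (auto simp: less_eq_vec_def)
  show "lam \<in> perturbation_class lam0 eps"
  proof (cases "eps = 0")
    case True
    \<comment> \<open>Without mass to rescale, the constraint forces \<open>lam = lam0\<close>: the
      differences are nonnegative and sum to zero.\<close>
    have "(\<Sum>k\<in>UNIV. lam $ k - lam0 $ k) = 0"
      by (simp add: sum_subtractf prob_simplex_sum lam lam0)
    then have "\<forall>k\<in>UNIV. lam $ k - lam0 $ k = 0"
      using le True by (subst (asm) sum_nonneg_eq_0_iff) auto
    then have "lam = lam0"
      by (simp add: vec_eq_iff)
    then show ?thesis
      using True lam0 by (auto simp: perturbation_class_def)
  next
    case False
    define q where "q = (1 / eps) *\<^sub>R (lam - (1 - eps) *\<^sub>R lam0)"
    have "(\<Sum>k\<in>UNIV. q $ k) = (1 / eps) * (\<Sum>k\<in>UNIV. lam $ k - (1 - eps) * lam0 $ k)"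
      by (simp add: q_def sum_distrib_left)
    also have "\<dots> = 1"
      using False by (simp add: sum_subtractf prob_simplex_sum lam lam0 flip: sum_distrib_left)
    finally have "q \<in> prob_simplex"
      using eps le by (auto simp: prob_simplex_def less_eq_vec_def q_def)
    moreover have "lam = (1 - eps) *\<^sub>R lam0 + eps *\<^sub>R q"
      using False by (simp add: q_def)
    ultimately show ?thesis
      by (auto simp: perturbation_class_def)
  qed
qed

lemma perturbation_class_0: "lam0 \<in> prob_simplex \<Longrightarrow> perturbation_class lam0 0 = {lam0}"
  by (auto simp: perturbation_class_def)

lemma perturbation_class_1: "perturbation_class lam0 1 = prob_simplex"
  by (auto simp: perturbation_class_def)

lemma weighted_loss_le_Max:
  assumes "lam \<in> prob_simplex"
  shows "weighted_loss \<sigma> Y lam a \<le> (MAX k. (std_dist \<sigma> Y k a)\<^sup>2)"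
proof -
  have "weighted_loss \<sigma> Y lam a \<le> (\<Sum>k\<in>UNIV. lam $ k * (MAX k. (std_dist \<sigma> Y k a)\<^sup>2))"
    unfolding weighted_loss_def
    by (intro sum_mono mult_left_mono prob_simplex_nonneg[OF assms] Max_ge) auto
  then show ?thesis
    by (simp add: prob_simplex_sum[OF assms] flip: sum_distrib_right)
qed

lemma weighted_loss_axis: "weighted_loss \<sigma> Y (axis k 1) a = (std_dist \<sigma> Y k a)\<^sup>2"
  by (simp add: weighted_loss_def axis_def if_distrib[where f = "\<lambda>x. x * _"] cong: if_cong)

text \<open>By linearity in the weights only the contribution of \<open>q\<close> varies over the
  class. A weighted mean of the squared distances is at most their maximum, and the vertex of the
  simplex at a maximizing index attains it.\<close>

lemma worst_case_risk_perturbation_class: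
  assumes lam0: "lam0 \<in> prob_simplex" and eps: "eps \<in> {0..1}"
  shows "worst_case_risk \<sigma> Y (perturbation_class lam0 eps) a =
    ((1 - eps) * weighted_loss \<sigma> Y lam0 a + eps * (MAX k. (std_dist \<sigma> Y k a)\<^sup>2)) + 1"
proof (rule antisym)
  obtain lam where "lam \<in> perturbation_class lam0 eps"
    and eq: "worst_case_risk \<sigma> Y (perturbation_class lam0 eps) a = weighted_loss \<sigma> Y lam a + 1"
    using worst_case_risk_attained compact_perturbation_class perturbation_class_nonempty[OF lam0]
    by metis
  then obtain q where "q \<in> prob_simplex" "lam = (1 - eps) *\<^sub>R lam0 + eps *\<^sub>R q"
    by (auto simp: perturbation_class_def)
  then show "worst_case_risk \<sigma> Y (perturbation_class lam0 eps) a \<le>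
      ((1 - eps) * weighted_loss \<sigma> Y lam0 a + eps * (MAX k. (std_dist \<sigma> Y k a)\<^sup>2)) + 1"
    using eps by (auto simp: eq weighted_loss_convex_combination intro!: mult_left_mono weighted_loss_le_Max)
next
  obtain k where k: "(MAX k. (std_dist \<sigma> Y k a)\<^sup>2) = (std_dist \<sigma> Y k a)\<^sup>2"
    using Max_in[of "range (\<lambda>k. (std_dist \<sigma> Y k a)\<^sup>2)"] by (auto simp: image_iff)
  have "(1 - eps) *\<^sub>R lam0 + eps *\<^sub>R axis k 1 \<in> perturbation_class lam0 eps"
    unfolding perturbation_class_def using axis_in_prob_simplex by blast
  from weighted_loss_le_worst_case_risk[OF compact_perturbation_class this]
  show "((1 - eps) * weighted_loss \<sigma> Y lam0 a + eps * (MAX k. (std_dist \<sigma> Y k a)\<^sup>2)) + 1 \<le>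
      worst_case_risk \<sigma> Y (perturbation_class lam0 eps) a"
    by (simp add: weighted_loss_convex_combination weighted_loss_axis k)
qed

section \<open>Convexity of the losses in the headline\<close>

lemma convex_on_std_dist_sq: "convex_on UNIV (\<lambda>a. (std_dist \<sigma> Y k a)\<^sup>2)"
proof (rule convex_onI)
  fix t x y :: real assume t: "0 < t" "t < 1"
  let ?s = "1 / \<sigma> $ k"
  let ?x = "(Y $ k - x) * ?s" and ?y = "(Y $ k - y) * ?s"
  \<comment> \<open>The Jensen gap of the square function, in closed form.\<close>
  have "(1 - t) * ?x\<^sup>2 + t * ?y\<^sup>2 - ((1 - t) * ?x + t * ?y)\<^sup>2 = t * (1 - t) * (?x - ?y)\<^sup>2"
    by algebra
  also have "\<dots> \<ge> 0"
    using t by simp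
  finally have "((1 - t) * ?x + t * ?y)\<^sup>2 \<le> (1 - t) * ?x\<^sup>2 + t * ?y\<^sup>2"
    by simp
  moreover have "(1 - t) * ?x + t * ?y = (Y $ k - ((1 - t) * x + t * y)) * ?s"
    by algebra
  ultimately show "(std_dist \<sigma> Y k ((1 - t) *\<^sub>R x + t *\<^sub>R y))\<^sup>2 \<le>
      (1 - t) * (std_dist \<sigma> Y k x)\<^sup>2 + t * (std_dist \<sigma> Y k y)\<^sup>2"
    by (simp add: std_dist_def power_divide)
qed simp

lemma convex_on_Max:
  fixes h :: "'i::finite \<Rightarrow> 'a::real_vector \<Rightarrow> real"
  assumes "\<And>k. convex_on S (h k)"
  shows "convex_on S (\<lambda>a. MAX k. h k a)"
proof (rule convex_onI)
  fix t :: real and x y assume t: "0 < t" "t < 1" and xy: "x \<in> S" "y \<in> S"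
  have "h k ((1 - t) *\<^sub>R x + t *\<^sub>R y) \<le> (1 - t) * (MAX k. h k x) + t * (MAX k. h k y)" for k
  proof -
    have "h k ((1 - t) *\<^sub>R x + t *\<^sub>R y) \<le> (1 - t) * h k x + t * h k y"
      using convex_onD[OF assms, of t x y k] t xy by simp
    also have "\<dots> \<le> (1 - t) * (MAX k. h k x) + t * (MAX k. h k y)"
      using t by (intro add_mono mult_left_mono Max_ge) auto
    finally show ?thesis .
  qed
  then show "(MAX k. h k ((1 - t) *\<^sub>R x + t *\<^sub>R y)) \<le> (1 - t) * (MAX k. h k x) + t * (MAX k. h k y)"
    by simp
qed (use assms convex_on_imp_convex in blast)

lemma convex_on_weighted_loss:
  assumes "lam \<in> prob_simplex"
  shows "convex_on UNIV (weighted_loss \<sigma> Y lam)"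
proof (rule convex_onI)
  fix t x y :: real assume t: "0 < t" "t < 1"
  have "weighted_loss \<sigma> Y lam ((1 - t) *\<^sub>R x + t *\<^sub>R y) \<le>
      (\<Sum>k\<in>UNIV. lam $ k * ((1 - t) * (std_dist \<sigma> Y k x)\<^sup>2 + t * (std_dist \<sigma> Y k y)\<^sup>2))"
    unfolding weighted_loss_def
    using t by (intro sum_mono mult_left_mono convex_onD[OF convex_on_std_dist_sq]
        prob_simplex_nonneg[OF assms]) auto
  also have "\<dots> = (1 - t) * weighted_loss \<sigma> Y lam x + t * weighted_loss \<sigma> Y lam y"
    unfolding weighted_loss_def sum_distrib_left sum.distrib[symmetric]
    by (simp add: algebra_simps)
  finally show "weighted_loss \<sigma> Y lam ((1 - t) *\<^sub>R x + t *\<^sub>R y) \<le>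
      (1 - t) * weighted_loss \<sigma> Y lam x + t * weighted_loss \<sigma> Y lam y" .
qed simp

subsection \<open>Minimizers of interpolated convex functions\<close>

text \<open>Quasiconvexity, used below when one end of the interval is a minimizer of
  \<open>f\<close>: the value at \<open>z\<close> is then bounded by the value at the other
  end.\<close>

lemma convex_on_le_max:
  fixes f :: "real \<Rightarrow> real"
  assumes "convex_on UNIV f" "x \<le> z" "z \<le> y"
  shows "f z \<le> max (f x) (f y)"
proof (cases "x = y")
  case False
  define u where "u = (z - x) / (y - x)"
  have u: "0 \<le> u" "u \<le> 1"
    using assms(2,3) False by (auto simp: u_def divide_simps)
  have "u * (y - x) = z - x"
    using False by (simp add: u_def)
  then have z: "z = (1 - u) * x + u * y"
    by (simp add: algebra_simps)
  have "f z \<le> (1 - u) * f x + u * f y"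
    using convex_onD[OF assms(1) u, of x y] by (simp add: z)
  also have "\<dots> \<le> (1 - u) * max (f x) (f y) + u * max (f x) (f y)"
    using u by (intro add_mono mult_left_mono) auto
  finally show ?thesis
    by (simp add: algebra_simps)
qed (use assms in auto)

text \<open>At \<open>e = 0\<close> and \<open>e = 1\<close> the hypothesis says that
  \<open>t 0\<close> minimizes \<open>f\<close> and \<open>t 1\<close> minimizes \<open>g\<close>. A
  point outside \<open>{t 0..t 1}\<close> is beaten by the nearer end. Inside, a backward step of
  the path would raise \<open>f\<close> while moving towards its minimizer, against
  quasiconvexity.\<close>

lemma minimizer_path_mono:
  fixes f g t :: "real \<Rightarrow> real"
  assumes f: "convex_on UNIV f" and g: "convex_on UNIV g"
    and min: "\<And>e a. e \<in> {0..1} \<Longrightarrow> a \<noteq> t e \<Longrightarrow>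
      (1 - e) * f (t e) + e * g (t e) < (1 - e) * f a + e * g a"
    and ends: "t 0 < t 1"
  shows "mono_on {0..1} t" and "e \<in> {0..1} \<Longrightarrow> t e \<in> {t 0..t 1}"
proof -
  have min0: "f (t 0) \<le> f a" and min1: "g (t 1) \<le> g a" for a
    using min[of 0 a] min[of 1 a] by force+
  show between: "t e \<in> {t 0..t 1}" if e: "e \<in> {0..1}" for e
  proof (rule ccontr)
    assume "t e \<notin> {t 0..t 1}"
    \<comment> \<open>The witness is the end of \<open>{t 0..t 1}\<close> nearer to
      \<open>t e\<close>: it minimizes one of the two functions, and quasiconvexity towards the far
      end handles the other.\<close>
    then obtain b where "b \<noteq> t e" "f b \<le> f (t e)" "g b \<le> g (t e)"
    proof (cases "t e < t 0")
      case True
      then have "g (t 0) \<le> max (g (t e)) (g (t 1))"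
        using ends by (intro convex_on_le_max[OF g]) auto
      then show ?thesis
        using that[of "t 0"] True min0 min1[of "t e"] by simp
    next
      case False
      then have gt: "t 1 < t e"
        using \<open>t e \<notin> {t 0..t 1}\<close> by simp
      then have "f (t 1) \<le> max (f (t 0)) (f (t e))"
        using ends by (intro convex_on_le_max[OF f]) auto
      then show ?thesis
        using that[of "t 1"] gt min1 min0[of "t e"] by simp
    qed
    then have "(1 - e) * f b + e * g b \<le> (1 - e) * f (t e) + e * g (t e)"
      using e by (intro add_mono mult_left_mono) auto
    then show False
      using min[OF e \<open>b \<noteq> t e\<close>] by simp
  qed
  show "mono_on {0..1} t"
  proof (intro mono_onI, rule ccontr)
    fix d e :: real assume de: "d \<in> {0..1}" "e \<in> {0..1}" "d \<le> e" and "\<not> t d \<le> t e"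
    then have lt: "t e < t d"
      by simp
    then have "d < e"
      using de(3) by (cases "d = e") auto
    have A: "0 < (1 - d) * (f (t e) - f (t d)) + d * (g (t e) - g (t d))"
      and B: "(1 - e) * (f (t e) - f (t d)) + e * (g (t e) - g (t d)) < 0"
      using min[OF de(1), of "t e"] min[OF de(2), of "t d"] lt by (auto simp: algebra_simps)
    \<comment> \<open>\<open>A\<close> and \<open>B\<close> compare \<open>t d\<close> with
      \<open>t e\<close> under the weights \<open>d\<close> and \<open>e\<close>. In
      \<open>e\<close> times the first minus \<open>d\<close> times the second the differences of
      \<open>g\<close> cancel, and those of \<open>f\<close> keep the factor
      \<open>e - d\<close>.\<close>
    have "0 < e * ((1 - d) * (f (t e) - f (t d)) + d * (g (t e) - g (t d)))"
      using A de \<open>d < e\<close> by (intro mult_pos_pos) auto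
    moreover have "d * ((1 - e) * (f (t e) - f (t d)) + e * (g (t e) - g (t d))) \<le> 0"
      using B de by (intro mult_nonneg_nonpos) auto
    ultimately have "0 < (e - d) * (f (t e) - f (t d))"
      by (simp add: algebra_simps)
    then have "f (t d) < f (t e)"
      using \<open>d < e\<close> by (simp add: zero_less_mult_iff)
    moreover have "f (t e) \<le> max (f (t 0)) (f (t d))"
      using between[OF de(2)] lt by (intro convex_on_le_max[OF f]) auto
    ultimately show False
      using min0[of "t d"] by simp
  qed
qed

lemma convex_on_uminus_arg:
  fixes f :: "real \<Rightarrow> real"
  assumes "convex_on UNIV f"
  shows "convex_on UNIV (\<lambda>x. f (- x))"
proof (rule convex_onI)
  fix t x y :: real assume "0 < t" "t < 1"
  then show "f (- ((1 - t) *\<^sub>R x + t *\<^sub>R y)) \<le> (1 - t) * f (- x) + t * f (- y)"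
    using convex_onD[OF assms, of t "- x" "- y"] by (simp add: algebra_simps)
qed simp

text \<open>Reflecting the line, \<open>x\<close> to \<open>- x\<close>, preserves convexity and
  exchanges the order of the end points, which reduces the claim to the increasing case.\<close>

lemma minimizer_path_antimono:
  fixes f g t :: "real \<Rightarrow> real"
  assumes f: "convex_on UNIV f" and g: "convex_on UNIV g"
    and min: "\<And>e a. e \<in> {0..1} \<Longrightarrow> a \<noteq> t e \<Longrightarrow>
      (1 - e) * f (t e) + e * g (t e) < (1 - e) * f a + e * g a"
    and ends: "t 1 < t 0"
  shows "antimono_on {0..1} t" and "e \<in> {0..1} \<Longrightarrow> t e \<in> {t 1..t 0}"
proof -
  let ?f = "\<lambda>x. f (- x)" and ?g = "\<lambda>x. g (- x)" and ?t = "\<lambda>e. - t e"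
  have min': "(1 - e) * ?f (?t e) + e * ?g (?t e) < (1 - e) * ?f a + e * ?g a"
    if "e \<in> {0..1}" "a \<noteq> ?t e" for e a
    using min[of e "- a"] that by (simp add: minus_equation_iff[of a])
  note * = minimizer_path_mono[of ?f ?g ?t, OF convex_on_uminus_arg[OF f] convex_on_uminus_arg[OF g] min']
  show "antimono_on {0..1} t"
    using *(1) ends by (auto simp: monotone_on_def)
  show "e \<in> {0..1} \<Longrightarrow> t e \<in> {t 1..t 0}"
    using *(2)[of e] ends by simp
qed

text \<open>A common minimizer of \<open>f\<close> and \<open>g\<close> minimizes every
  interpolation, and strictness of the minimum leaves no other.\<close>

lemma minimizer_path_const:
  fixes f g t :: "real \<Rightarrow> real"
  assumes min: "\<And>e a. e \<in> {0..1} \<Longrightarrow> a \<noteq> t e \<Longrightarrow>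
      (1 - e) * f (t e) + e * g (t e) < (1 - e) * f a + e * g a"
    and ends: "t 0 = t 1" and e: "e \<in> {0..1}"
  shows "t e = t 0"
proof (rule ccontr)
  assume ne: "t e \<noteq> t 0"
  have "f (t 0) \<le> f (t e)" "g (t 0) \<le> g (t e)"
    using min[of 0 "t e"] min[of 1 "t e"] ne ends by force+
  then have "(1 - e) * f (t 0) + e * g (t 0) \<le> (1 - e) * f (t e) + e * g (t e)"
    using e by (intro add_mono mult_left_mono) auto
  then show False
    using min[OF e, of "t 0"] ne by simp
qed

text \<open>Confines the path to a compact interval, whatever the order of its end points, so that
  \<open>f - g\<close> is bounded along it.\<close>

lemma minimizer_path_bounds:
  fixes f g t :: "real \<Rightarrow> real"
  assumes f: "convex_on UNIV f" and g: "convex_on UNIV g"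
    and min: "\<And>e a. e \<in> {0..1} \<Longrightarrow> a \<noteq> t e \<Longrightarrow>
      (1 - e) * f (t e) + e * g (t e) < (1 - e) * f a + e * g a"
    and e: "e \<in> {0..1}"
  shows "t e \<in> {min (t 0) (t 1)..max (t 0) (t 1)}"
proof (cases "t 0" "t 1" rule: linorder_cases)
  case less
  have "t e \<in> {t 0..t 1}"
    by (rule minimizer_path_mono(2)[OF f g _ less e]) (rule min)
  then show ?thesis
    by (simp add: min_def max_def)
next
  case equal
  have "t e = t 0"
    by (rule minimizer_path_const[OF _ equal e]) (rule min)
  then show ?thesis
    by simp
next
  case greater
  have "t e \<in> {t 1..t 0}"
    by (rule minimizer_path_antimono(2)[OF f g _ greater e]) (rule min)
  then show ?thesis
    by (simp add: min_def max_def)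
qed

text \<open>
  Quadratic growth around the minimizers bounds \<open>c (t e - t d)\<^sup>2\<close> by \<open>\<bar>e - d\<bar>\<close> times the oscillation
  of \<open>f - g\<close> between the endpoints of the path.
\<close>

lemma continuous_on_minimizer_path:
  fixes f g t :: "real \<Rightarrow> real"
  assumes f: "convex_on UNIV f" and g: "convex_on UNIV g" and c: "c > 0"
    and growth: "\<And>e a. e \<in> {0..1} \<Longrightarrow>
      (1 - e) * f (t e) + e * g (t e) + c * (a - t e)\<^sup>2 \<le> (1 - e) * f a + e * g a"
  shows "continuous_on {0..1} t"
proof -
  have min: "(1 - e) * f (t e) + e * g (t e) < (1 - e) * f a + e * g a"
    if "e \<in> {0..1}" "a \<noteq> t e" for e a
  proof -
    have "0 < c * (a - t e)\<^sup>2"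
      using c that by simp
    then show ?thesis
      using growth[OF that(1), of a] by linarith
  qed
  let ?I = "{min (t 0) (t 1)..max (t 0) (t 1)}"
  have "continuous_on UNIV (\<lambda>a. f a - g a)"
    by (intro continuous_on_diff convex_on_continuous f g open_UNIV)
  then have "bounded ((\<lambda>a. f a - g a) ` ?I)"
    by (intro compact_imp_bounded compact_continuous_image) (auto intro: continuous_on_subset)
  then obtain M where "\<forall>x \<in> (\<lambda>a. f a - g a) ` ?I. norm x \<le> M"
    unfolding bounded_iff by blast
  then have M: "\<bar>f a - g a\<bar> \<le> M" if "a \<in> ?I" for a
    using imageI[OF that, of "\<lambda>a. f a - g a"] unfolding real_norm_def by blast
  have bound: "(t e - t d)\<^sup>2 \<le> M / c * \<bar>e - d\<bar>" if d: "d \<in> {0..1}" and e: "e \<in> {0..1}" for d e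
  proof -
    \<comment> \<open>Growth around \<open>t d\<close> is tested at \<open>t e\<close> and growth
      around \<open>t e\<close> at \<open>t d\<close>. Adding the two doubles the quadratic term and
      leaves \<open>e - d\<close> times the change of \<open>f - g\<close>.\<close>
    have "2 * (c * (t e - t d)\<^sup>2) \<le> (e - d) * ((f (t e) - g (t e)) - (f (t d) - g (t d)))"
      using growth[OF d, of "t e"] growth[OF e, of "t d"]
      by (simp add: algebra_simps power2_eq_square)
    also have "\<dots> \<le> \<bar>e - d\<bar> * \<bar>(f (t e) - g (t e)) - (f (t d) - g (t d))\<bar>"
      by (metis abs_ge_self abs_mult)
    also have "\<dots> \<le> \<bar>e - d\<bar> * (2 * M)"
      using M[OF minimizer_path_bounds[OF f g min d]] M[OF minimizer_path_bounds[OF f g min e]]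
      by (intro mult_left_mono) auto
    finally show ?thesis
      using c by (simp add: field_simps)
  qed
  show ?thesis
    unfolding continuous_on_def
  proof
    fix d :: real assume d: "d \<in> {0..1}"
    \<comment> \<open>The bound is a Hoelder estimate of exponent 1/2; its square root is a majorant
      that vanishes at \<open>d\<close>.\<close>
    have "((\<lambda>e. sqrt (M / c * \<bar>e - d\<bar>)) \<longlongrightarrow> sqrt (M / c * \<bar>d - d\<bar>)) (at d within {0..1})"
      by (intro tendsto_intros)
    then have "((\<lambda>e. sqrt (M / c * \<bar>e - d\<bar>)) \<longlongrightarrow> 0) (at d within {0..1})"
      by simp
    moreover have "\<forall>\<^sub>F e in at d within {0..1}. norm (t e - t d) \<le> sqrt (M / c * \<bar>e - d\<bar>)"
    proof -
      have "\<forall>\<^sub>F e in at d within {0..1}. e \<in> {0..1}"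
        by (simp add: eventually_at_filter)
      then show ?thesis
      proof eventually_elim
        case (elim e)
        show ?case
          by (rule real_le_rsqrt) (use bound[OF d elim] in \<open>simp only: real_norm_def power2_abs\<close>)
      qed
    qed
    ultimately have "((\<lambda>e. t e - t d) \<longlongrightarrow> 0) (at d within {0..1})"
      by (rule Lim_null_comparison[rotated])
    then show "(t \<longlongrightarrow> t d) (at d within {0..1})"
      by (rule LIM_zero_cancel)
  qed
qed

subsection \<open>Two sources\<close>

text \<open>The ratio peaks where \<open>p * s = (1 - p) * r\<close>, that is at
  \<open>p = r / (r + s)\<close>. The hypothesis \<open>between\<close> puts \<open>p\<close>
  between \<open>q\<close> and the peak, with denominators cleared. After cross multiplication the
  difference of the two sides has the factor \<open>p - q\<close>, and the cofactor has the same
  sign.\<close>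

lemma unimodal_ratio:
  fixes r s p q :: real
  assumes "r > 0" "s > 0" and q: "q \<in> {0..1}" and p: "p \<in> {0..1}"
    and between: "(q \<le> p \<and> p * s \<le> (1 - p) * r) \<or> (p \<le> q \<and> (1 - p) * r \<le> p * s)"
  shows "q * (1 - q) / (q * s\<^sup>2 + (1 - q) * r\<^sup>2) \<le> p * (1 - p) / (p * s\<^sup>2 + (1 - p) * r\<^sup>2)"
proof -
  have denom: "x * s\<^sup>2 + (1 - x) * r\<^sup>2 > 0" if "x \<in> {0..1}" for x
    using that assms(1,2) by (cases "x = 0") (auto intro!: add_pos_nonneg)
  have "0 \<le> (p - q) * ((1 - q) * r * ((1 - p) * r) - q * s * (p * s))"
  proof (cases "q \<le> p \<and> p * s \<le> (1 - p) * r")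
    case True
    \<comment> \<open>\<open>q\<close> lies on the same side of the peak as \<open>p\<close>, only
      further out, so it inherits the inequality; multiplying the two gives the sign of the
      cofactor.\<close>
    then have "q * s \<le> (1 - q) * r"
      using assms(1,2) by (meson diff_left_mono less_imp_le mult_right_mono order_trans)
    then show ?thesis
      using True p q assms(1,2) by (intro mult_nonneg_nonneg) (auto intro!: mult_mono)
  next
    case False
    then have le: "p \<le> q" "(1 - p) * r \<le> p * s"
      using between by auto
    then have "(1 - q) * r \<le> q * s"
      using assms(1,2) by (meson diff_left_mono less_imp_le mult_right_mono order_trans)
    then show ?thesis
      using le p q assms(1,2) by (intro mult_nonpos_nonpos) (auto intro!: mult_mono)
  qed
  also have "\<dots> = p * (1 - p) * (q * s\<^sup>2 + (1 - q) * r\<^sup>2) - q * (1 - q) * (p * s\<^sup>2 + (1 - p) * r\<^sup>2)"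
    by algebra
  finally show ?thesis
    using denom[OF p] denom[OF q] by (simp add: divide_le_eq pos_le_divide_eq mult.commute)
qed

lemma nearest_point_Icc:
  fixes l u x c :: real
  assumes "l \<le> u"
  shows "is_arg_min (\<lambda>x. \<bar>x - c\<bar>) (\<lambda>x. x \<in> {l..u}) x \<longleftrightarrow> x = min (max c l) u"
proof
  assume "is_arg_min (\<lambda>x. \<bar>x - c\<bar>) (\<lambda>x. x \<in> {l..u}) x"
  then have "x \<in> {l..u}" and "\<bar>x - c\<bar> \<le> \<bar>min (max c l) u - c\<bar>"
    using assms by (auto simp: is_arg_min_linorder)
  then show "x = min (max c l) u"
    by (auto simp: min_def max_def abs_if split: if_splits)
next
  assume "x = min (max c l) u"
  then show "is_arg_min (\<lambda>x. \<bar>x - c\<bar>) (\<lambda>x. x \<in> {l..u}) x"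
    using assms by (auto simp: is_arg_min_linorder min_def max_def)
qed

text \<open>For \<open>eps \<ge> 0\<close> the interval is nonempty and its nearest point to
  \<open>p_Delta s1 s2\<close> is unique, so the choice operator in \<open>p_star\<close> agrees
  with clipping.\<close>

lemma p_star_eq:
  assumes "eps \<in> {0..1}"
  shows "is_arg_min (\<lambda>x. \<bar>x - p_Delta s1 s2\<bar>) (\<lambda>x. x \<in> weight_interval p0 eps) x \<longleftrightarrow> x = p_star s1 s2 p0 eps"
    and "p_star s1 s2 p0 eps = min (max (p_Delta s1 s2) ((1 - eps) * p0)) ((1 - eps) * p0 + eps)"
proof -
  have iff: "is_arg_min (\<lambda>x. \<bar>x - p_Delta s1 s2\<bar>) (\<lambda>x. x \<in> weight_interval p0 eps) x \<longleftrightarrow>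
      x = min (max (p_Delta s1 s2) ((1 - eps) * p0)) ((1 - eps) * p0 + eps)" for x
    unfolding weight_interval_def using assms by (intro nearest_point_Icc) auto
  show eq: "p_star s1 s2 p0 eps = min (max (p_Delta s1 s2) ((1 - eps) * p0)) ((1 - eps) * p0 + eps)"
    unfolding p_star_def arg_min_on_def arg_min_def iff by simp
  show "is_arg_min (\<lambda>x. \<bar>x - p_Delta s1 s2\<bar>) (\<lambda>x. x \<in> weight_interval p0 eps) x \<longleftrightarrow> x = p_star s1 s2 p0 eps"
    unfolding iff eq ..
qed

section \<open>Dispersion and perturbation classes in terms of one weight\<close>

lemma UNIV_eq_pair:
  assumes "CARD('k::finite) = 2" "i \<noteq> (j :: 'k)"
  shows "UNIV = {i, j}"
  using assms by (intro sym[OF card_subset_eq]) auto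

lemma dispersion_two:
  fixes \<sigma> Y lam :: "real ^ 'k"
  assumes pos: "\<And>k. \<sigma> $ k > 0" and two: "CARD('k) = 2" "i \<noteq> j" and lam: "lam \<in> prob_simplex"
  shows "precision_mean \<sigma> Y lam =
      (lam $ i * Y $ i / (\<sigma> $ i)\<^sup>2 + (1 - lam $ i) * Y $ j / (\<sigma> $ j)\<^sup>2) /
      (lam $ i / (\<sigma> $ i)\<^sup>2 + (1 - lam $ i) / (\<sigma> $ j)\<^sup>2)"
    and "dispersion \<sigma> Y lam =
      lam $ i * (1 - lam $ i) * (Y $ i - Y $ j)\<^sup>2 /
      (lam $ i * (\<sigma> $ j)\<^sup>2 + (1 - lam $ i) * (\<sigma> $ i)\<^sup>2)"
proof -
  note U = UNIV_eq_pair[OF two]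
  have lam_j: "lam $ j = 1 - lam $ i"
    using prob_simplex_sum[OF lam] two(2) by (simp add: U)
  define p where "p = lam $ i"
  have p: "0 \<le> p" "p \<le> 1"
    using prob_simplex_nonneg[OF lam, of i] prob_simplex_nonneg[OF lam, of j] lam_j by (auto simp: p_def)
  define s r where "s = \<sigma> $ j" and "r = \<sigma> $ i"
  have sr: "s > 0" "r > 0"
    using pos by (auto simp: s_def r_def)
  define D where "D = p * s\<^sup>2 + (1 - p) * r\<^sup>2"
  have D: "D > 0"
    unfolding D_def using p sr by (cases "p = 0") (auto intro!: add_pos_nonneg)
  show pm: "precision_mean \<sigma> Y lam =
      (lam $ i * Y $ i / (\<sigma> $ i)\<^sup>2 + (1 - lam $ i) * Y $ j / (\<sigma> $ j)\<^sup>2) /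
      (lam $ i / (\<sigma> $ i)\<^sup>2 + (1 - lam $ i) / (\<sigma> $ j)\<^sup>2)"
    using two(2) by (simp add: precision_mean_def U lam_j)
  define m where "m = precision_mean \<sigma> Y lam"
  have "p * Y $ i / r\<^sup>2 + (1 - p) * Y $ j / s\<^sup>2 = (p * s\<^sup>2 * Y $ i + (1 - p) * r\<^sup>2 * Y $ j) / (r\<^sup>2 * s\<^sup>2)"
    and "p / r\<^sup>2 + (1 - p) / s\<^sup>2 = D / (r\<^sup>2 * s\<^sup>2)"
    using sr by (simp_all add: field_simps D_def)
  then have m: "m = (p * s\<^sup>2 * Y $ i + (1 - p) * r\<^sup>2 * Y $ j) / D"
    using sr by (simp add: m_def pm flip: p_def s_def r_def)
  \<comment> \<open>Both deviations from the mean are multiples of \<open>Y $ i - Y $ j\<close>, so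
    the dispersion is a multiple of its square.\<close>
  have mi: "Y $ i - m = (1 - p) * r\<^sup>2 * (Y $ i - Y $ j) / D"
    and mj: "Y $ j - m = - (p * s\<^sup>2 * (Y $ i - Y $ j) / D)"
    using D by (simp_all add: m field_simps) (simp_all add: D_def algebra_simps)
  have "dispersion \<sigma> Y lam = p * ((Y $ i - m) / r)\<^sup>2 + (1 - p) * ((Y $ j - m) / s)\<^sup>2"
    using two(2) by (simp add: dispersion_def U lam_j std_dist_def power_divide m_def p_def s_def r_def)
  \<comment> \<open>The two terms share \<open>p * (1 - p)\<close>, and what remains of them adds up
    to \<open>D\<close>, cancelling one of the two factors \<open>D\<close> below.\<close>
  also have "\<dots> = p * (1 - p) * (Y $ i - Y $ j)\<^sup>2 * (p * s\<^sup>2 + (1 - p) * r\<^sup>2) / D\<^sup>2"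
    using sr D by (simp add: mi mj power2_eq_square field_simps)
  also have "\<dots> = p * (1 - p) * (Y $ i - Y $ j)\<^sup>2 / D"
    using D unfolding D_def[symmetric] power2_eq_square[of D] by simp
  finally show "dispersion \<sigma> Y lam =
      lam $ i * (1 - lam $ i) * (Y $ i - Y $ j)\<^sup>2 /
      (lam $ i * (\<sigma> $ j)\<^sup>2 + (1 - lam $ i) * (\<sigma> $ i)\<^sup>2)"
    by (simp add: D_def p_def s_def r_def)
qed

text \<open>The lower bound on coordinate \<open>j\<close> is an upper bound on coordinate
  \<open>i\<close>, since the weights sum to one. The interval lies within \<open>{0..1}\<close>, so
  membership also gives nonnegativity.\<close>

lemma perturbation_class_two:
  fixes lam0 lam :: "real ^ 'k"
  assumes two: "CARD('k) = 2" "i \<noteq> j" and lam0: "lam0 \<in> prob_simplex" and eps: "eps \<in> {0..1}"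
  shows "lam \<in> perturbation_class lam0 eps \<longleftrightarrow>
    lam $ j = 1 - lam $ i \<and> lam $ i \<in> weight_interval (lam0 $ i) eps"
proof -
  note U = UNIV_eq_pair[OF two]
  have all: "(\<forall>k. P k) \<longleftrightarrow> P i \<and> P j" for P
    using U by (metis UNIV_I insertE singletonD)
  have lam0_i: "0 \<le> (1 - eps) * lam0 $ i" "(1 - eps) * lam0 $ i \<le> 1 - eps" and lam0_j: "lam0 $ j = 1 - lam0 $ i"
    using prob_simplex_nonneg[OF lam0, of i] prob_simplex_nonneg[OF lam0, of j]
      prob_simplex_sum[OF lam0] two(2) eps by (auto simp: U intro!: mult_left_le)
  show ?thesis
    unfolding perturbation_class_eq_lower_bounded[OF lam0 eps] weight_interval_def
    using lam0_i two(2)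
    by (auto simp: prob_simplex_def less_eq_vec_def all U lam0_j algebra_simps)
qed

text \<open>The dispersion is a nonnegative multiple of the unimodal ratio, and the clipped point
  lies between the peak and every other point of the interval. A maximizer is exhibited without
  uniqueness: for \<open>Y $ i = Y $ j\<close> the dispersion vanishes throughout the class.\<close>

lemma p_star_max_dispersion:
  fixes \<sigma> Y lam0 :: "real ^ 'k"
  assumes pos: "\<And>k. \<sigma> $ k > 0" and two: "CARD('k) = 2" "i \<noteq> j"
    and lam0: "lam0 \<in> prob_simplex" and eps: "eps \<in> {0..1}"
  obtains lam where "is_arg_max (dispersion \<sigma> Y) (\<lambda>lam. lam \<in> perturbation_class lam0 eps) lam"
    and "lam $ i = p_star (\<sigma> $ i) (\<sigma> $ j) (lam0 $ i) eps"
proof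
  define p where "p = p_star (\<sigma> $ i) (\<sigma> $ j) (lam0 $ i) eps"
  define lam :: "real ^ 'k" where "lam = (\<chi> k. if k = i then p else 1 - p)"
  show i: "lam $ i = p_star (\<sigma> $ i) (\<sigma> $ j) (lam0 $ i) eps"
    by (simp add: lam_def p_def)
  have p: "p \<in> weight_interval (lam0 $ i) eps"
    using p_star_eq(1)[OF eps, of "\<sigma> $ i" "\<sigma> $ j" "lam0 $ i" p] by (simp add: p_def is_arg_min_def)
  then have lam: "lam \<in> perturbation_class lam0 eps"
    using two by (simp add: perturbation_class_two[OF two lam0 eps] lam_def)
  have "dispersion \<sigma> Y mu \<le> dispersion \<sigma> Y lam" if mu: "mu \<in> perturbation_class lam0 eps" for mu
  proof -
    have simplex: "mu \<in> prob_simplex" "lam \<in> prob_simplex"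
      using mu lam perturbation_class_subset[OF lam0 eps] by auto
    define q where "q = mu $ i"
    have unit: "nu $ i \<in> {0..1}" if "nu \<in> prob_simplex" for nu :: "real ^ 'k"
      using prob_simplex_nonneg[OF that, of i] prob_simplex_nonneg[OF that, of j]
        prob_simplex_sum[OF that] two(2) by (auto simp: UNIV_eq_pair[OF two])
    have q: "q \<in> weight_interval (lam0 $ i) eps"
      using mu by (simp add: perturbation_class_two[OF two lam0 eps] q_def)
    have sum_pos: "\<sigma> $ i + \<sigma> $ j > 0"
      using pos by (simp add: add_pos_pos)
    have "(q \<le> p \<and> p \<le> p_Delta (\<sigma> $ i) (\<sigma> $ j)) \<or> (p \<le> q \<and> p_Delta (\<sigma> $ i) (\<sigma> $ j) \<le> p)"
      using q unfolding p_def p_star_eq(2)[OF eps] weight_interval_def by (auto simp: min_def max_def)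
    then have "(q \<le> p \<and> p * \<sigma> $ j \<le> (1 - p) * \<sigma> $ i) \<or> (p \<le> q \<and> (1 - p) * \<sigma> $ i \<le> p * \<sigma> $ j)"
      using sum_pos by (auto simp: p_Delta_def field_simps)
    then have "q * (1 - q) / (q * (\<sigma> $ j)\<^sup>2 + (1 - q) * (\<sigma> $ i)\<^sup>2) \<le>
        p * (1 - p) / (p * (\<sigma> $ j)\<^sup>2 + (1 - p) * (\<sigma> $ i)\<^sup>2)"
      using unit[OF simplex(1)] unit[OF simplex(2)] i pos
      by (intro unimodal_ratio) (auto simp: p_def q_def)
    from mult_right_mono[OF this, of "(Y $ i - Y $ j)\<^sup>2"] show ?thesis
      by (simp add: dispersion_two[OF pos two simplex(1)] dispersion_two[OF pos two simplex(2)]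
          i flip: p_def q_def)
  qed
  then show "is_arg_max (dispersion \<sigma> Y) (\<lambda>lam. lam \<in> perturbation_class lam0 eps) lam"
    using lam by (simp add: is_arg_max_linorder)
qed

subsection \<open>Optimal headline under perturbed weights\<close>

theorem proposition4:
  fixes Y \<sigma> lam0 :: "real ^ 'k"
  assumes "CARD('k) \<ge> 2"
    and "\<And>k. \<sigma> $ k > 0"
    and "lam0 \<in> prob_simplex"
  shows
    "let R = \<lambda>eps. worst_case_risk \<sigma> Y (perturbation_class lam0 eps);
         \<theta> = \<lambda>eps. optimal_headline \<sigma> Y (perturbation_class lam0 eps);
         \<theta>\<Delta> = optimal_headline \<sigma> Y prob_simplex
     in
     (\<forall>eps\<in>{0..1}.
        (\<forall>a. is_arg_min (R eps) (\<lambda>_. True) a \<longleftrightarrow> a = \<theta> eps) \<and>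
        (\<forall>a. R eps a =
           ((1 - eps) * (\<Sum>k\<in>UNIV. lam0 $ k * (std_dist \<sigma> Y k a)\<^sup>2)
             + eps * (MAX k. (std_dist \<sigma> Y k a)\<^sup>2)) + 1) \<and>
        (\<exists>lam. is_arg_max (dispersion \<sigma> Y)
                  (\<lambda>lam. lam \<in> prob_simplex \<and> (1 - eps) *\<^sub>R lam0 \<le> lam) lam) \<and>
        (\<forall>lam. is_arg_max (dispersion \<sigma> Y)
                  (\<lambda>lam. lam \<in> prob_simplex \<and> (1 - eps) *\<^sub>R lam0 \<le> lam) lam \<longrightarrow>
           \<theta> eps = precision_mean \<sigma> Y lam \<and>
           R eps (\<theta> eps) = dispersion \<sigma> Y lam + 1)) \<and>
     continuous_on {0..1} \<theta> \<and>
     (\<theta> 0 < \<theta> 1 \<longrightarrow> mono_on {0..1} \<theta>) \<and>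
     (\<theta> 0 > \<theta> 1 \<longrightarrow> antimono_on {0..1} \<theta>) \<and>
     (\<theta> 0 = \<theta> 1 \<longrightarrow> (\<forall>eps\<in>{0..1}. \<theta> eps = \<theta> 0)) \<and>
     \<theta> 0 = precision_mean \<sigma> Y lam0 \<and>
     precision_mean \<sigma> Y lam0 =
       (\<Sum>k\<in>UNIV. lam0 $ k * Y $ k / (\<sigma> $ k)\<^sup>2) / (\<Sum>k\<in>UNIV. lam0 $ k / (\<sigma> $ k)\<^sup>2) \<and>
     \<theta> 1 = \<theta>\<Delta> \<and>
     (CARD('k) = 2 \<longrightarrow>
       (\<forall>i j. i \<noteq> j \<longrightarrow>
         (let p0 = lam0 $ i;
              p\<Delta> = p_Delta (\<sigma> $ i) (\<sigma> $ j);
              p = p_star (\<sigma> $ i) (\<sigma> $ j) p0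
          in
            (\<forall>eps\<in>{0..1}.
               (\<forall>x. is_arg_min (\<lambda>x. \<bar>x - p\<Delta>\<bar>) (\<lambda>x. x \<in> weight_interval p0 eps) x
                     \<longleftrightarrow> x = p eps) \<and>
               p eps = min (max p\<Delta> ((1 - eps) * p0)) ((1 - eps) * p0 + eps) \<and>
               \<theta> eps =
                 (p eps * Y $ i / (\<sigma> $ i)\<^sup>2 + (1 - p eps) * Y $ j / (\<sigma> $ j)\<^sup>2) /
                 (p eps / (\<sigma> $ i)\<^sup>2 + (1 - p eps) / (\<sigma> $ j)\<^sup>2) \<and>
               R eps (\<theta> eps) =
                 p eps * (1 - p eps) * (Y $ i - Y $ j)\<^sup>2 /
                 (p eps * (\<sigma> $ j)\<^sup>2 + (1 - p eps) * (\<sigma> $ i)\<^sup>2) + 1 \<and>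
               (p\<Delta> \<in> weight_interval p0 eps \<longrightarrow> \<theta> eps = \<theta>\<Delta>) \<and>
               (p0 \<in> {0<..<1} \<and> eps \<ge> max (1 - p\<Delta> / p0) (1 - (1 - p\<Delta>) / (1 - p0)) \<longrightarrow>
                  \<theta> eps = \<theta>\<Delta>)))))"
proof -
  define R where "R = (\<lambda>eps. worst_case_risk \<sigma> Y (perturbation_class lam0 eps))"
  define \<theta> where "\<theta> = (\<lambda>eps. optimal_headline \<sigma> Y (perturbation_class lam0 eps))"
  note pos = assms(2) and lam0 = assms(3)
  let ?max = "\<lambda>eps. is_arg_max (dispersion \<sigma> Y) (\<lambda>lam. lam \<in> perturbation_class lam0 eps)"
  \<comment> \<open>\<open>f\<close> and \<open>g\<close> are the worst-case risks at
    \<open>eps = 0\<close> and \<open>eps = 1\<close>, less the constant one.\<close>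
  define f where "f = weighted_loss \<sigma> Y lam0"
  define g where "g a = (MAX k. (std_dist \<sigma> Y k a)\<^sup>2)" for a
  have R_eq: "R eps a = ((1 - eps) * f a + eps * g a) + 1" if "eps \<in> {0..1}" for eps a
    using worst_case_risk_perturbation_class[OF lam0 that] by (simp add: R_def f_def g_def)
  have max_iff: "is_arg_max (dispersion \<sigma> Y) (\<lambda>lam. lam \<in> prob_simplex \<and> (1 - eps) *\<^sub>R lam0 \<le> lam) =
      ?max eps" if "eps \<in> {0..1}" for eps
    by (simp add: perturbation_class_eq_lower_bounded[OF lam0 that])
  have max_ex: "\<exists>lam. ?max eps lam" if "eps \<in> {0..1}" for eps
    using max_dispersion_exists[OF pos perturbation_class_subset[OF lam0 that] compact_perturbation_class
        perturbation_class_nonempty[OF lam0]] by metis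
  have \<theta>_eq: "\<theta> eps = precision_mean \<sigma> Y lam"
    and R_\<theta>: "R eps (\<theta> eps) = dispersion \<sigma> Y lam + 1"
    and R_growth: "R eps (\<theta> eps) + total_precision \<sigma> lam * (a - \<theta> eps)\<^sup>2 \<le> R eps a"
    and argmin_iff: "is_arg_min (R eps) (\<lambda>_. True) a \<longleftrightarrow> a = \<theta> eps"
    if eps: "eps \<in> {0..1}" and lam: "?max eps lam" for eps lam a
  proof -
    note * = pos perturbation_class_subset[OF lam0 eps] convex_perturbation_class
      compact_perturbation_class lam
    show eq: "\<theta> eps = precision_mean \<sigma> Y lam"
      unfolding \<theta>_def by (rule optimal_headline_eq_precision_mean(2)[OF *])
    show "R eps (\<theta> eps) = dispersion \<sigma> Y lam + 1"
      unfolding eq R_def by (rule worst_case_risk_at_max_dispersion(1)[OF *])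
    show "R eps (\<theta> eps) + total_precision \<sigma> lam * (a - \<theta> eps)\<^sup>2 \<le> R eps a"
      unfolding eq R_def by (rule worst_case_risk_at_max_dispersion(2)[OF *])
    show "is_arg_min (R eps) (\<lambda>_. True) a \<longleftrightarrow> a = \<theta> eps"
      unfolding eq R_def by (rule optimal_headline_eq_precision_mean(1)[OF *])
  qed
  have convex: "convex_on UNIV f" "convex_on UNIV g"
    unfolding f_def g_def
    by (intro convex_on_weighted_loss lam0) (intro convex_on_Max convex_on_std_dist_sq)
  \<comment> \<open>The maximizer, and with it \<open>total_precision\<close>, changes with
    \<open>eps\<close>; continuity of the path needs a growth constant that does not.\<close>
  obtain c where c: "c > 0" "\<And>lam. lam \<in> prob_simplex \<Longrightarrow> c \<le> total_precision \<sigma> lam"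
    using total_precision_bounded_below[OF pos] by blast
  have growth: "(1 - e) * f (\<theta> e) + e * g (\<theta> e) + c * (a - \<theta> e)\<^sup>2 \<le> (1 - e) * f a + e * g a"
    if e: "e \<in> {0..1}" for e a
  proof -
    obtain lam where lam: "?max e lam"
      using max_ex[OF e] by blast
    then have "c \<le> total_precision \<sigma> lam"
      using perturbation_class_subset[OF lam0 e] by (intro c(2)) (auto simp: is_arg_max_def)
    then have "c * (a - \<theta> e)\<^sup>2 \<le> total_precision \<sigma> lam * (a - \<theta> e)\<^sup>2"
      by (rule mult_right_mono) simp
    then show ?thesis
      using R_growth[OF e lam, of a] by (simp add: R_eq[OF e])
  qed
  have min: "(1 - e) * f (\<theta> e) + e * g (\<theta> e) < (1 - e) * f a + e * g a"
    if e: "e \<in> {0..1}" and a: "a \<noteq> \<theta> e" for e a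
  proof -
    have "0 < c * (a - \<theta> e)\<^sup>2"
      using c(1) a by simp
    then show ?thesis
      using growth[OF e, of a] by linarith
  qed
  have general: "\<forall>eps\<in>{0..1}. (\<forall>a. is_arg_min (R eps) (\<lambda>_. True) a \<longleftrightarrow> a = \<theta> eps) \<and>
      (\<forall>a. R eps a =
        ((1 - eps) * (\<Sum>k\<in>UNIV. lam0 $ k * (std_dist \<sigma> Y k a)\<^sup>2)
          + eps * (MAX k. (std_dist \<sigma> Y k a)\<^sup>2)) + 1) \<and>
      (\<exists>lam. is_arg_max (dispersion \<sigma> Y)
                (\<lambda>lam. lam \<in> prob_simplex \<and> (1 - eps) *\<^sub>R lam0 \<le> lam) lam) \<and>
      (\<forall>lam. is_arg_max (dispersion \<sigma> Y)
                (\<lambda>lam. lam \<in> prob_simplex \<and> (1 - eps) *\<^sub>R lam0 \<le> lam) lam \<longrightarrow>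
         \<theta> eps = precision_mean \<sigma> Y lam \<and> R eps (\<theta> eps) = dispersion \<sigma> Y lam + 1)"
    (is "\<forall>eps\<in>_. ?P eps")
  proof
    fix eps :: real assume eps: "eps \<in> {0..1}"
    show "?P eps"
      unfolding max_iff[OF eps]
    proof (intro conjI allI impI)
      show "is_arg_min (R eps) (\<lambda>_. True) a \<longleftrightarrow> a = \<theta> eps" for a
        using max_ex[OF eps] argmin_iff[OF eps] by blast
      show "R eps a = ((1 - eps) * (\<Sum>k\<in>UNIV. lam0 $ k * (std_dist \<sigma> Y k a)\<^sup>2)
          + eps * (MAX k. (std_dist \<sigma> Y k a)\<^sup>2)) + 1" for a
        unfolding R_eq[OF eps] f_def g_def weighted_loss_def ..
    qed (rule max_ex[OF eps] \<theta>_eq[OF eps] R_\<theta>[OF eps], assumption?)+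
  qed
  have path: "continuous_on {0..1} \<theta>"
    "\<theta> 0 < \<theta> 1 \<longrightarrow> mono_on {0..1} \<theta>"
    "\<theta> 0 > \<theta> 1 \<longrightarrow> antimono_on {0..1} \<theta>"
    "\<theta> 0 = \<theta> 1 \<longrightarrow> (\<forall>eps\<in>{0..1}. \<theta> eps = \<theta> 0)"
  proof -
    show "continuous_on {0..1} \<theta>"
      using convex c(1) growth by (rule continuous_on_minimizer_path)
    show "\<theta> 0 < \<theta> 1 \<longrightarrow> mono_on {0..1} \<theta>"
      by (intro impI minimizer_path_mono(1)[OF convex]) (rule min)
    show "\<theta> 0 > \<theta> 1 \<longrightarrow> antimono_on {0..1} \<theta>"
      by (intro impI minimizer_path_antimono(1)[OF convex]) (rule min)
    show "\<theta> 0 = \<theta> 1 \<longrightarrow> (\<forall>eps\<in>{0..1}. \<theta> eps = \<theta> 0)"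
      by (intro impI ballI minimizer_path_const[of \<theta> f g]) (rule min)
  qed
  \<comment> \<open>At \<open>eps = 0\<close> the class is the singleton \<open>{lam0}\<close>, so
    \<open>lam0\<close> is trivially the maximizer.\<close>
  have \<theta>_0: "\<theta> 0 = precision_mean \<sigma> Y lam0"
    by (intro \<theta>_eq) (simp_all add: perturbation_class_0[OF lam0] is_arg_max_linorder)
  have \<theta>_1: "\<theta> 1 = optimal_headline \<sigma> Y prob_simplex"
    by (simp add: \<theta>_def perturbation_class_1)
  have two_weights: "let p0 = lam0 $ i;
              p\<Delta> = p_Delta (\<sigma> $ i) (\<sigma> $ j);
              p = p_star (\<sigma> $ i) (\<sigma> $ j) p0
          in
            (\<forall>eps\<in>{0..1}.
               (\<forall>x. is_arg_min (\<lambda>x. \<bar>x - p\<Delta>\<bar>) (\<lambda>x. x \<in> weight_interval p0 eps) x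
                     \<longleftrightarrow> x = p eps) \<and>
               p eps = min (max p\<Delta> ((1 - eps) * p0)) ((1 - eps) * p0 + eps) \<and>
               \<theta> eps =
                 (p eps * Y $ i / (\<sigma> $ i)\<^sup>2 + (1 - p eps) * Y $ j / (\<sigma> $ j)\<^sup>2) /
                 (p eps / (\<sigma> $ i)\<^sup>2 + (1 - p eps) / (\<sigma> $ j)\<^sup>2) \<and>
               R eps (\<theta> eps) =
                 p eps * (1 - p eps) * (Y $ i - Y $ j)\<^sup>2 /
                 (p eps * (\<sigma> $ j)\<^sup>2 + (1 - p eps) * (\<sigma> $ i)\<^sup>2) + 1 \<and>
               (p\<Delta> \<in> weight_interval p0 eps \<longrightarrow> \<theta> eps = \<theta> 1) \<and>
               (p0 \<in> {0<..<1} \<and> eps \<ge> max (1 - p\<Delta> / p0) (1 - (1 - p\<Delta>) / (1 - p0)) \<longrightarrow>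
                  \<theta> eps = \<theta> 1))"
    if two: "CARD('k) = 2" "i \<noteq> j" for i j
  proof -
    define p0 where "p0 = lam0 $ i"
    define p\<Delta> where "p\<Delta> = p_Delta (\<sigma> $ i) (\<sigma> $ j)"
    define p where "p = p_star (\<sigma> $ i) (\<sigma> $ j) p0"
    have formulas: "\<theta> eps =
        (p eps * Y $ i / (\<sigma> $ i)\<^sup>2 + (1 - p eps) * Y $ j / (\<sigma> $ j)\<^sup>2) /
        (p eps / (\<sigma> $ i)\<^sup>2 + (1 - p eps) / (\<sigma> $ j)\<^sup>2)"
      "R eps (\<theta> eps) =
        p eps * (1 - p eps) * (Y $ i - Y $ j)\<^sup>2 /
        (p eps * (\<sigma> $ j)\<^sup>2 + (1 - p eps) * (\<sigma> $ i)\<^sup>2) + 1"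
      if eps: "eps \<in> {0..1}" for eps
    proof -
      \<comment> \<open>Any one maximizer determines headline and risk, so the one with first weight
        \<open>p eps\<close> yields the closed forms.\<close>
      obtain lam where lam: "?max eps lam" and i: "lam $ i = p eps"
        using p_star_max_dispersion[OF pos two lam0 eps] unfolding p_def p0_def by metis
      have "lam \<in> prob_simplex"
        using lam perturbation_class_subset[OF lam0 eps] by (auto simp: is_arg_max_def)
      note * = dispersion_two[OF pos two this, of Y, unfolded i]
      show "\<theta> eps =
          (p eps * Y $ i / (\<sigma> $ i)\<^sup>2 + (1 - p eps) * Y $ j / (\<sigma> $ j)\<^sup>2) /
          (p eps / (\<sigma> $ i)\<^sup>2 + (1 - p eps) / (\<sigma> $ j)\<^sup>2)"
        using \<theta>_eq[OF eps lam] *(1) by simp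
      show "R eps (\<theta> eps) =
          p eps * (1 - p eps) * (Y $ i - Y $ j)\<^sup>2 /
          (p eps * (\<sigma> $ j)\<^sup>2 + (1 - p eps) * (\<sigma> $ i)\<^sup>2) + 1"
        using R_\<theta>[OF eps lam] *(2) by simp
    qed
    have p_eq: "p eps = min (max p\<Delta> ((1 - eps) * p0)) ((1 - eps) * p0 + eps)"
      if "eps \<in> {0..1}" for eps
      unfolding p_def p\<Delta>_def by (rule p_star_eq(2)[OF that])
    \<comment> \<open>At \<open>eps = 1\<close> the interval is all of \<open>{0..1}\<close>, so
      clipping leaves the peak where it is.\<close>
    have "p\<Delta> \<in> {0..1}"
      using pos[of i] pos[of j] by (auto simp: p\<Delta>_def p_Delta_def divide_simps)
    then have p_1: "p 1 = p\<Delta>"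
      by (simp add: p_eq)
    have inside: "\<theta> eps = \<theta> 1" if eps: "eps \<in> {0..1}" and "p\<Delta> \<in> weight_interval p0 eps" for eps
    proof -
      \<comment> \<open>The closed form of the headline depends on \<open>eps\<close> only through
        \<open>p eps\<close>, so equal weights give equal headlines.\<close>
      have "p eps = p 1"
        using that(2) unfolding p_1 p_eq[OF eps] by (auto simp: weight_interval_def)
      then show ?thesis
        using formulas(1)[OF eps] formulas(1)[of 1] by simp
    qed
    have threshold: "p\<Delta> \<in> weight_interval p0 eps"
      if p0: "p0 \<in> {0<..<1}" and eps: "eps \<ge> max (1 - p\<Delta> / p0) (1 - (1 - p\<Delta>) / (1 - p0))" for eps
    proof -
      have "1 - eps \<le> p\<Delta> / p0" "1 - eps \<le> (1 - p\<Delta>) / (1 - p0)"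
        using eps by auto
      \<comment> \<open>The two thresholds are the two end-point conditions of the interval; the
        second, rearranged, reads \<open>p\<Delta> \<le> (1 - eps) * p0 + eps\<close>.\<close>
      then have "(1 - eps) * p0 \<le> p\<Delta>" "(1 - eps) * (1 - p0) \<le> 1 - p\<Delta>"
        using p0 by (simp_all add: pos_le_divide_eq)
      then show ?thesis
        by (simp add: weight_interval_def algebra_simps)
    qed
    show ?thesis
      unfolding Let_def p0_def[symmetric] p\<Delta>_def[symmetric] p_def[symmetric]
    proof (intro ballI conjI allI impI)
      fix eps x :: real assume eps: "eps \<in> {0..1}"
      show "is_arg_min (\<lambda>x. \<bar>x - p\<Delta>\<bar>) (\<lambda>x. x \<in> weight_interval p0 eps) x \<longleftrightarrow> x = p eps"
        unfolding p_def p\<Delta>_def by (rule p_star_eq(1)[OF eps])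
      show "\<theta> eps = \<theta> 1" if "p\<Delta> \<in> weight_interval p0 eps"
        by (rule inside[OF eps that])
      show "\<theta> eps = \<theta> 1"
        if "p0 \<in> {0<..<1} \<and> eps \<ge> max (1 - p\<Delta> / p0) (1 - (1 - p\<Delta>) / (1 - p0))"
        using that by (intro inside[OF eps] threshold) simp_all
    qed (rule p_eq formulas, assumption)+
  qed
  show ?thesis
    unfolding Let_def R_def[symmetric] \<theta>_def[symmetric] \<theta>_1[symmetric]
    by (intro conjI general path \<theta>_0 refl precision_mean_def)
       (intro allI impI two_weights[unfolded Let_def])
qed

end
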